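(* Let $\mathcal J=(M,\lambda,\tau)$ be a noetherian reduction structure with disjoint cones and well-founded order $\prec$. Suppose that for all $x^\delta,x^{\delta'},x^\varepsilon\in\mathcal T$, $x^\delta\succ x^{\delta'}$ implies $x^{\delta+\varepsilon}\succ x^{\delta'+\varepsilon}\succeq x^\varepsilon$. Then for a marked set $\mathcal F$ over $\mathcal J$ the following are equivalent: (i) $\mathcal F$ is a marked basis; (ii) for all $x^\alpha,x^{\alpha'}\in M$ such that $\operatorname{lcm}(x^\alpha,x^{\alpha'})\in\operatorname{cone}(x^{\alpha'})$ it holds $S(f_{\alpha'},f_\alpha)\rightarrow^+_{\mathcal F\mathcal J}0\downarrow$; (iii) for all $x^\alpha,x^{\alpha'}\in M$ such that $x^{\gamma+\alpha}=\operatorname{lcm}(x^\alpha,x^{\alpha'})\in\operatorname{cone}(x^{\alpha'})$ it holds $x^\gamma f_\alpha\rightarrow^+_{\mathcal F\mathcal J}0\downarrow$.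
   Context: Let $A$ be a field, $\mathcal P=A[x_1,\dots,x_n]$, and $\mathcal T$ the set of terms $x^\alpha=x_1^{\alpha_1}\cdots x_n^{\alpha_n}$, $\alpha\in\mathbb N^n$. $\operatorname{Supp}(g)\subset\mathcal T$ is the set of terms with nonzero coefficient in $g$; $\langle V\rangle$ is the $A$-span of $V\subset\mathcal P$ and $(V)$ the ideal of $\mathcal P$ generated by $V$. A semigroup ideal is a subset of $\mathcal T$ closed under multiplication by terms; an order ideal is the complement in $\mathcal T$ of a semigroup ideal. A reduction structure (RS) is a triple $\mathcal J=(M,\lambda=\{\lambda_\alpha\}_{x^\alpha\in M},\tau=\{\tau_\alpha\}_{x^\alpha\in M})$ where $M\subset\mathcal T$ is finite, $J$ denotes the semigroup ideal generated by $M$, each $\tau_\alpha\subseteq\mathcal T$ is an order ideal, $\operatorname{cone}(x^\alpha)=\{x^{\alpha+\eta}: x^\eta\in\tau_\alpha\}$, $\bigcup_{x^\alpha\in M}\operatorname{cone}(x^\alpha)=J$, and $\lambda_\alpha\subseteq\mathcal T\setminus\operatorname{cone}(x^\alpha)$. $\mathsf N(J)=\mathcal T\setminus J$. All RSs are assumed to have finite tails: every $\lambda_\alpha$ is finite. $\mathcal J$ has disjoint cones if $\operatorname{cone}(x^\alpha)\cap\operatorname{cone}(x^{\alpha'})=\emptyset$ for distinct $x^\alpha,x^{\alpha'}\in M$. A marked set over $\mathcal J$ is a set $\mathcal F=\{f_\alpha\}_{x^\alpha\in M}\subset\mathcal P$ such that $x^\alpha$ has coefficient $1$ in $f_\alpha$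 and $\operatorname{Supp}(f_\alpha-x^\alpha)\subset\lambda_\alpha$. It is a marked basis if $(\mathcal F)\oplus\langle\mathsf N(J)\rangle=\mathcal P$. The S-polynomial is $S(f_{\alpha'},f_\alpha)=x^\eta f_\alpha-x^{\eta'}f_{\alpha'}$, where $x^{\eta+\alpha}=x^{\eta'+\alpha'}=\operatorname{lcm}(x^\alpha,x^{\alpha'})$. One-step reduction: $g\rightarrow_{\mathcal F\mathcal J}h$ if there are $x^\gamma\in\operatorname{Supp}(g)$ with coefficient $c$ in $g$, $x^\alpha\in M$ and $x^\eta\in\tau_\alpha$ with $x^\gamma=x^{\alpha+\eta}$ and $h=g-cx^\eta f_\alpha$. $\rightarrow^+_{\mathcal F\mathcal J}$ is the reflexive-transitive closure. $g\rightarrow^+_{\mathcal F\mathcal J}l\downarrow$ means $g\rightarrow^+_{\mathcal F\mathcal J}l$ and $\operatorname{Supp}(l)\subset\mathsf N(J)$. $\mathcal J$ is noetherian if for every marked set over it there is no infinite chain of one-step reductions. $\mathcal J$ is ordered by a well-founded order $\prec$ on $\mathcal T$ (a strict partial order for which every nonempty subset has minimal elements) if $x^{\gamma+\eta}\prec x^{\alpha+\eta}$ for all $x^\alpha\in M$, $x^\gamma\in\lambda_\alpha$, $x^\eta\in\tau_\alpha$. Noetherian and ordered are treated as synonyms, and a noetherian $\mathcal J$ comes with a fixed such order $\prec$. *)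

theory Defs
  imports Complex_Main "HOL-Library.Poly_Mapping"
begin

text \<open>
  The finite type \<open>'n\<close> indexes the variables. A term is identified with its exponent
  vector \<open>\<alpha> :: 'n \<Rightarrow>\<^sub>0 nat\<close>, so multiplication of terms is addition of exponents and the
  term \<open>1\<close> is \<open>0\<close>. Polynomials form the monoid algebra \<open>('n \<Rightarrow>\<^sub>0 nat) \<Rightarrow>\<^sub>0 'a\<close> with the
  convolution product of the library; \<open>keys\<close> is the support, \<open>lookup\<close> the coefficient
  function and \<open>single \<alpha> c\<close> the monomial with coefficient \<open>c\<close> and exponent \<open>\<alpha>\<close>.
\<close>

type_synonym 'n expo = "'n \<Rightarrow>\<^sub>0 nat"
type_synonym ('n, 'a) mpoly = "('n \<Rightarrow>\<^sub>0 nat) \<Rightarrow>\<^sub>0 'a"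

interpretation poly_ideal: module "(*) :: ('n::finite, 'a::field) mpoly \<Rightarrow> ('n, 'a) mpoly \<Rightarrow> _"
  by unfold_locales (simp_all add: algebra_simps)

definition scale_poly :: "'a::field \<Rightarrow> ('n::finite, 'a) mpoly \<Rightarrow> ('n, 'a) mpoly" where
  "scale_poly c p = Poly_Mapping.single 0 c * p"

interpretation poly_space: vector_space
  "scale_poly :: 'a::field \<Rightarrow> ('n::finite, 'a) mpoly \<Rightarrow> ('n, 'a) mpoly"
  by unfold_locales
    (simp_all add: scale_poly_def distrib_left distrib_right single_add mult_single
      flip: mult.assoc)

definition lcm_expo :: "'n::finite expo \<Rightarrow> 'n expo \<Rightarrow> 'n expo" where
  "lcm_expo \<alpha> \<beta> =
    Abs_poly_mapping (\<lambda>i. max (Poly_Mapping.lookup \<alpha> i) (Poly_Mapping.lookup \<beta> i))"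

lemma lookup_lcm_expo [simp]:
  "Poly_Mapping.lookup (lcm_expo \<alpha> \<beta>) i =
    max (Poly_Mapping.lookup \<alpha> i) (Poly_Mapping.lookup \<beta> i)"
  by (simp add: lcm_expo_def)

definition semigroup_ideal :: "'n::finite expo set \<Rightarrow> bool" where
  "semigroup_ideal S \<longleftrightarrow> (\<forall>\<alpha>\<in>S. \<forall>\<eta>. \<alpha> + \<eta> \<in> S)"

definition order_ideal :: "'n::finite expo set \<Rightarrow> bool" where
  "order_ideal S \<longleftrightarrow> semigroup_ideal (- S)"

text \<open>
  The triple \<open>(M, \<lambda>, \<tau>)\<close>. The values of \<open>tail\<close> and \<open>mult\<close> outside \<open>heads\<close> are irrelevant.
\<close>

record 'n red_triple =
  heads :: "'n expo set"
  tail :: "'n expo \<Rightarrow> 'n expo set"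
  mult :: "'n expo \<Rightarrow> 'n expo set"

definition head_ideal :: "'n::finite red_triple \<Rightarrow> 'n expo set" where
  "head_ideal J = semigroup_ideal hull heads J"

definition residual :: "'n::finite red_triple \<Rightarrow> 'n expo set" where
  "residual J = - head_ideal J"

definition cone :: "'n::finite red_triple \<Rightarrow> 'n expo \<Rightarrow> 'n expo set" where
  "cone J \<alpha> = {\<alpha> + \<eta> | \<eta>. \<eta> \<in> mult J \<alpha>}"

text \<open>Finiteness of the tails is part of the notion.\<close>

definition reduction_structure :: "'n::finite red_triple \<Rightarrow> bool" where
  "reduction_structure J \<longleftrightarrow>
    finite (heads J) \<and>
    (\<forall>\<alpha>\<in>heads J. order_ideal (mult J \<alpha>)) \<and>
    (\<Union>\<alpha>\<in>heads J. cone J \<alpha>) = head_ideal J \<and>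
    (\<forall>\<alpha>\<in>heads J. tail J \<alpha> \<subseteq> - cone J \<alpha>) \<and>
    (\<forall>\<alpha>\<in>heads J. finite (tail J \<alpha>))"

definition disjoint_cones :: "'n::finite red_triple \<Rightarrow> bool" where
  "disjoint_cones J \<longleftrightarrow>
    (\<forall>\<alpha>\<in>heads J. \<forall>\<beta>\<in>heads J. \<alpha> \<noteq> \<beta> \<longrightarrow> cone J \<alpha> \<inter> cone J \<beta> = {})"

text \<open>
  A marked set \<open>{f\<^sub>\<alpha>}\<close> is given as a family \<open>F\<close> indexed by exponents, of which only the members
  with index in \<open>heads J\<close> matter.
\<close>

definition marked_set ::
    "'n::finite red_triple \<Rightarrow> ('n expo \<Rightarrow> ('n, 'a::field) mpoly) \<Rightarrow> bool" where
  "marked_set J F \<longleftrightarrow>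
    (\<forall>\<alpha>\<in>heads J. Poly_Mapping.lookup (F \<alpha>) \<alpha> = 1 \<and>
       Poly_Mapping.keys (F \<alpha> - Poly_Mapping.single \<alpha> 1) \<subseteq> tail J \<alpha>)"

definition is_direct_sum :: "('n::finite, 'a::field) mpoly set \<Rightarrow> ('n, 'a) mpoly set \<Rightarrow> bool" where
  "is_direct_sum U V \<longleftrightarrow> U \<inter> V = {0} \<and> {u + v | u v. u \<in> U \<and> v \<in> V} = UNIV"

definition marked_basis ::
    "'n::finite red_triple \<Rightarrow> ('n expo \<Rightarrow> ('n, 'a::field) mpoly) \<Rightarrow> bool" where
  "marked_basis J F \<longleftrightarrow>
    marked_set J F \<and>
    is_direct_sum (poly_ideal.span (F ` heads J))
      (poly_space.span ((\<lambda>\<beta>. Poly_Mapping.single \<beta> 1) ` residual J))"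

text \<open>\<open>spoly F \<alpha>' \<alpha>\<close> is \<open>S(f\<^sub>\<alpha>\<^sub>', f\<^sub>\<alpha>)\<close>; the subtractions of exponents are exact.\<close>

definition spoly ::
    "('n::finite expo \<Rightarrow> ('n, 'a::field) mpoly) \<Rightarrow> 'n expo \<Rightarrow> 'n expo \<Rightarrow> ('n, 'a) mpoly" where
  "spoly F \<alpha>' \<alpha> =
    Poly_Mapping.single (lcm_expo \<alpha> \<alpha>' - \<alpha>) 1 * F \<alpha> -
    Poly_Mapping.single (lcm_expo \<alpha> \<alpha>' - \<alpha>') 1 * F \<alpha>'"

definition red_step ::
    "'n::finite red_triple \<Rightarrow> ('n expo \<Rightarrow> ('n, 'a::field) mpoly) \<Rightarrow>
      ('n, 'a) mpoly \<Rightarrow> ('n, 'a) mpoly \<Rightarrow> bool" where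
  "red_step J F g h \<longleftrightarrow>
    (\<exists>\<gamma>\<in>Poly_Mapping.keys g. \<exists>\<alpha>\<in>heads J. \<exists>\<eta>\<in>mult J \<alpha>.
       \<gamma> = \<alpha> + \<eta> \<and> h = g - Poly_Mapping.single \<eta> (Poly_Mapping.lookup g \<gamma>) * F \<alpha>)"

definition reduces_fully ::
    "'n::finite red_triple \<Rightarrow> ('n expo \<Rightarrow> ('n, 'a::field) mpoly) \<Rightarrow>
      ('n, 'a) mpoly \<Rightarrow> ('n, 'a) mpoly \<Rightarrow> bool" where
  "reduces_fully J F g l \<longleftrightarrow>
    (red_step J F)\<^sup>*\<^sup>* g l \<and> Poly_Mapping.keys l \<subseteq> residual J"

text \<open>The type argument is the coefficient field, which is not determined by \<open>J\<close>.\<close>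

definition noetherian_rs :: "'a::field itself \<Rightarrow> 'n::finite red_triple \<Rightarrow> bool" where
  "noetherian_rs _ J \<longleftrightarrow>
    (\<forall>F :: 'n expo \<Rightarrow> ('n, 'a) mpoly. marked_set J F \<longrightarrow>
       (\<nexists>g. \<forall>i::nat. red_step J F (g i) (g (Suc i))))"

definition well_founded_order :: "('b \<Rightarrow> 'b \<Rightarrow> bool) \<Rightarrow> bool" where
  "well_founded_order prec \<longleftrightarrow> irreflp prec \<and> transp prec \<and> wfp prec"

definition ordered_by ::
    "'n::finite red_triple \<Rightarrow> ('n expo \<Rightarrow> 'n expo \<Rightarrow> bool) \<Rightarrow> bool" where
  "ordered_by J prec \<longleftrightarrow>
    well_founded_order prec \<and>
    (\<forall>\<alpha>\<in>heads J. \<forall>\<gamma>\<in>tail J \<alpha>. \<forall>\<eta>\<in>mult J \<alpha>. prec (\<gamma> + \<eta>) (\<alpha> + \<eta>))"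

end

theory Submission
  imports Defs
begin

text \<open>
  Let \<open>W\<close> be the vector space spanned by the multiples \<open>x\<^sup>\<eta> f\<^sub>\<alpha>\<close> with \<open>\<alpha> \<in> heads J\<close> and
  \<open>\<eta> \<in> mult J \<alpha>\<close>, that is, by the polynomials that a reduction step may subtract. Reduction
  terminates, and an irreducible polynomial is supported in \<open>residual J\<close>, so every polynomial is
  the sum of an element of \<open>W\<close> and one supported in \<open>residual J\<close>. The sum is direct
  (lemma \<open>cone_span_residual\<close>): as the cones are disjoint, distinct spanning multiples
  have distinct heads, so in a linear combination a maximal head cannot cancel, and it lies in
  \<open>head_ideal J\<close>. Hence a polynomial reduces to \<open>0\<close> if and only if it lies in \<open>W\<close>, and \<open>F\<close> is a
  marked basis if and only if \<open>W\<close> is the ideal generated by \<open>F\<close>.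

  This settles everything except that the S-polynomial criterion forces \<open>W\<close> to be an ideal, which
  means \<open>x\<^sup>\<gamma> f\<^sub>\<alpha> \<in> W\<close> for all \<open>\<gamma>\<close>. Suppose first that the cone of \<open>\<alpha>\<close> is not
  empty (lemma \<open>multiple_in_cone_span\<close>); the proof is by induction on the head
  \<open>x\<^sup>\<gamma>\<^sup>+\<^sup>\<alpha>\<close>. This head is in the cone of some \<open>\<alpha>'\<close>, and then so is the least common multiple
  of \<open>x\<^sup>\<alpha>\<close> and \<open>x\<^sup>\<alpha>\<^sup>'\<close>. Thus \<open>x\<^sup>\<gamma> f\<^sub>\<alpha>\<close> differs from an element of \<open>W\<close> by a
  multiple \<open>x\<^sup>\<delta> S\<close> of an S-polynomial. All terms of \<open>S\<close>, and hence all heads used in reducing it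
  to \<open>0\<close>, are smaller than this least common multiple. Multiplication by \<open>x\<^sup>\<delta>\<close> preserves the
  order, so \<open>x\<^sup>\<delta> S\<close> is a combination of multiples of the \<open>f\<^sub>\<beta>\<close> whose heads are smaller than
  \<open>x\<^sup>\<gamma>\<^sup>+\<^sup>\<alpha>\<close>, to which the induction hypothesis applies. An \<open>\<alpha>\<close> with empty cone
  is in the cone of another head, which brings \<open>f\<^sub>\<alpha>\<close> back to the first case
  (lemma \<open>ideal_subset_cone_span\<close>).
\<close>

section \<open>Polynomials as linear combinations of terms\<close>

lemma lookup_monomial_mult:
  fixes p :: "('n::finite, 'a::field) mpoly"
  shows "Poly_Mapping.lookup (Poly_Mapping.single \<eta> c * p) (\<kappa> + \<eta>) =
    c * Poly_Mapping.lookup p \<kappa>"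
  by (simp add: lookup_mult lookup_single when_mult add.commute[of \<kappa>])

lemma keys_monomial_mult:
  fixes p :: "('n::finite, 'a::field) mpoly"
  shows "Poly_Mapping.keys (Poly_Mapping.single \<eta> c * p) \<subseteq> (\<lambda>\<kappa>. \<kappa> + \<eta>) ` Poly_Mapping.keys p"
  using keys_mult[of "Poly_Mapping.single \<eta> c" p] by (fastforce simp: add.commute split: if_splits)

lemma lookup_scale_poly:
  "Poly_Mapping.lookup (scale_poly c p) \<kappa> = c * Poly_Mapping.lookup p \<kappa>"
  using lookup_monomial_mult[of 0 c p \<kappa>] by (simp add: scale_poly_def)

lemma scale_poly_monomial_mult:
  "scale_poly c (Poly_Mapping.single \<eta> 1 * p) = Poly_Mapping.single \<eta> c * p"
  by (simp add: scale_poly_def mult_single flip: mult.assoc)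

lemma poly_eq_sum_terms:
  "p = (\<Sum>\<kappa>\<in>Poly_Mapping.keys p. Poly_Mapping.single \<kappa> (Poly_Mapping.lookup p \<kappa>))"
  by (rule poly_mapping_eqI)
    (auto simp: lookup_sum lookup_single when_def in_keys_iff)

lemma in_span_terms_iff:
  fixes p :: "('n::finite, 'a::field) mpoly"
  shows "p \<in> poly_space.span ((\<lambda>\<beta>. Poly_Mapping.single \<beta> 1) ` S) \<longleftrightarrow> Poly_Mapping.keys p \<subseteq> S"
    (is "p \<in> ?V \<longleftrightarrow> _")
proof
  have "?V \<subseteq> {p. \<forall>\<kappa>. \<kappa> \<notin> S \<longrightarrow> Poly_Mapping.lookup p \<kappa> = 0}"
    by (rule poly_space.span_minimal)
      (auto simp: poly_space.subspace_def lookup_single when_def lookup_add lookup_scale_poly)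
  then show "p \<in> ?V \<Longrightarrow> Poly_Mapping.keys p \<subseteq> S"
    by (auto simp: in_keys_iff)
next
  assume S: "Poly_Mapping.keys p \<subseteq> S"
  have "Poly_Mapping.single \<kappa> (Poly_Mapping.lookup p \<kappa>) \<in> ?V"
    if "\<kappa> \<in> Poly_Mapping.keys p" for \<kappa>
  proof -
    have "Poly_Mapping.single \<kappa> (Poly_Mapping.lookup p \<kappa>) =
        scale_poly (Poly_Mapping.lookup p \<kappa>) (Poly_Mapping.single \<kappa> 1)"
      by (simp add: scale_poly_def mult_single)
    also have "\<dots> \<in> ?V"
      using S that by (intro poly_space.span_scale poly_space.span_base) auto
    finally show ?thesis .
  qed
  then show "p \<in> ?V"
    by (subst poly_eq_sum_terms) (rule poly_space.span_sum)
qed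

lemma subspace_mult_preimage:
  fixes q :: "('n::finite, 'a::field) mpoly"
  assumes "poly_space.subspace V"
  shows "poly_space.subspace {p. q * p \<in> V}"
proof -
  have "q * scale_poly c p = scale_poly c (q * p)" for c and p :: "('n, 'a) mpoly"
    by (simp add: scale_poly_def mult.left_commute)
  then show ?thesis
    using assms by (auto simp: poly_space.subspace_def distrib_left)
qed

lemma mult_in_subspace_if_monomial_mult:
  fixes p q :: "('n::finite, 'a::field) mpoly"
  assumes V: "poly_space.subspace V" and p: "\<And>\<gamma>. Poly_Mapping.single \<gamma> 1 * p \<in> V"
  shows "q * p \<in> V"
proof -
  have "q * p =
      (\<Sum>\<kappa>\<in>Poly_Mapping.keys q. Poly_Mapping.single \<kappa> (Poly_Mapping.lookup q \<kappa>) * p)"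
    by (subst poly_eq_sum_terms[of q]) (rule sum_distrib_right)
  also have "\<dots> \<in> V"
    using poly_space.subspace_scale[OF V p]
    by (intro poly_space.subspace_sum[OF V]) (simp add: scale_poly_monomial_mult)
  finally show ?thesis .
qed

lemma ideal_span_subset_subspace:
  fixes B :: "('n::finite, 'a::field) mpoly set"
  assumes V: "poly_space.subspace V"
    and B: "\<And>f \<gamma>. f \<in> B \<Longrightarrow> Poly_Mapping.single \<gamma> 1 * f \<in> V"
  shows "poly_ideal.span B \<subseteq> V"
proof -
  have "poly_ideal.span B \<subseteq> {p. \<forall>q. q * p \<in> V}"
  proof (rule poly_ideal.span_minimal)
    show "B \<subseteq> {p. \<forall>q. q * p \<in> V}"
      using mult_in_subspace_if_monomial_mult[OF V B] by blast
    show "poly_ideal.subspace {p. \<forall>q. q * p \<in> V}"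
      using V by (auto simp: poly_ideal.subspace_def poly_space.subspace_def distrib_left
          simp flip: mult.assoc)
  qed
  then show ?thesis
    by (metis (mono_tags, lifting) mem_Collect_eq mult_1 subset_iff)
qed

text \<open>
  A maximal head cannot cancel: it is the head of only one summand, and as a tail term of another
  summand it would be smaller than that summand's head.
\<close>

lemma head_in_keys_combination:
  fixes r :: "('n::finite, 'a::field) mpoly \<Rightarrow> 'a"
  assumes "transp prec" and "irreflp prec" and "finite T"
    and one: "\<And>a. a \<in> T \<Longrightarrow> Poly_Mapping.lookup a (h a) = 1"
    and less: "\<And>a \<kappa>. a \<in> T \<Longrightarrow> \<kappa> \<in> Poly_Mapping.keys a \<Longrightarrow> \<kappa> \<noteq> h a \<Longrightarrow> prec \<kappa> (h a)"
    and inj: "inj_on h T"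
    and nonzero: "(\<Sum>a\<in>T. scale_poly (r a) a) \<noteq> 0"
  shows "\<exists>a\<in>T. h a \<in> Poly_Mapping.keys (\<Sum>a\<in>T. scale_poly (r a) a)"
proof -
  define U where "U = {a \<in> T. r a \<noteq> 0}"
  have "U \<noteq> {}"
    using nonzero by (auto simp: U_def intro!: sum.neutral)
  have "asymp_on (h ` U) prec" and "transp_on (h ` U) prec"
    using assms(1,2) by (auto intro: asymp_on_subset transp_on_subset asymp_on_iff_irreflp_on_if_transp_on[THEN iffD2])
  then obtain m where "m \<in> h ` U" and "\<forall>x\<in>h ` U. x \<noteq> m \<longrightarrow> \<not> prec m x"
    using Finite_Set.bex_max_element[of "h ` U" prec] \<open>finite T\<close> \<open>U \<noteq> {}\<close> U_def by auto
  then obtain a where a: "a \<in> U" and max: "\<And>b. b \<in> U \<Longrightarrow> h b \<noteq> h a \<Longrightarrow> \<not> prec (h a) (h b)"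
    by blast
  have "r b * Poly_Mapping.lookup b (h a) = (if b = a then r a else 0)" if "b \<in> T" for b
  proof (cases "b = a \<or> r b = 0")
    case True
    then show ?thesis
      using a one by (auto simp: U_def)
  next
    case False
    then have "b \<in> U" and "h b \<noteq> h a"
      using that a inj by (auto simp: U_def inj_on_def)
    then have "h a \<notin> Poly_Mapping.keys b"
      using max less[OF that, of "h a"] by auto
    then show ?thesis
      using False by (simp add: in_keys_iff)
  qed
  then have "Poly_Mapping.lookup (\<Sum>a\<in>T. scale_poly (r a) a) (h a) = r a"
    using a \<open>finite T\<close> by (simp add: lookup_sum lookup_scale_poly U_def)
  then have "h a \<in> Poly_Mapping.keys (\<Sum>a\<in>T. scale_poly (r a) a)"
    using a by (simp add: U_def in_keys_iff)
  then show ?thesis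
    using a by (auto simp: U_def)
qed

section \<open>Reduction and the span of the cone multiples\<close>

lemma head_ideal_upward:
  assumes "\<alpha> \<in> head_ideal J"
  shows "\<alpha> + \<eta> \<in> head_ideal J"
  using assms unfolding head_ideal_def hull_def semigroup_ideal_def by blast

lemma heads_subset_head_ideal: "heads J \<subseteq> head_ideal J"
  unfolding head_ideal_def by (rule hull_subset)

lemma order_ideal_downward:
  assumes "order_ideal S" and "\<alpha> + \<eta> \<in> S"
  shows "\<alpha> \<in> S"
  using assms unfolding order_ideal_def semigroup_ideal_def by blast

lemma lcm_expo_minus_add [simp]:
  "lcm_expo \<alpha> \<beta> - \<alpha> + \<alpha> = lcm_expo \<alpha> \<beta>" "lcm_expo \<alpha> \<beta> - \<beta> + \<beta> = lcm_expo \<alpha> \<beta>"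
  by (auto intro!: poly_mapping_eqI simp: lookup_add lookup_minus)

lemma lcm_expo_dvd:
  assumes "\<gamma> + \<alpha> = \<eta> + \<beta>"
  obtains \<delta> where "\<gamma> + \<alpha> = lcm_expo \<alpha> \<beta> + \<delta>"
proof
  have "Poly_Mapping.lookup (\<gamma> + \<alpha>) i = Poly_Mapping.lookup (\<eta> + \<beta>) i" for i
    using assms by simp
  then have "Poly_Mapping.lookup \<beta> i \<le> Poly_Mapping.lookup \<gamma> i + Poly_Mapping.lookup \<alpha> i" for i
    by (metis le_add2 lookup_add)
  then show "\<gamma> + \<alpha> = lcm_expo \<alpha> \<beta> + (\<gamma> + \<alpha> - lcm_expo \<alpha> \<beta>)"
    by (intro poly_mapping_eqI) (simp add: lookup_add lookup_minus)
qed

locale ordered_marked_set =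
  fixes J :: "'n::finite red_triple"
    and prec :: "'n expo \<Rightarrow> 'n expo \<Rightarrow> bool"
    and F :: "'n expo \<Rightarrow> ('n, 'a::field) mpoly"
  assumes rs: "reduction_structure J"
    and noetherian: "noetherian_rs TYPE('a) J"
    and disjoint: "disjoint_cones J"
    and ordered: "ordered_by J prec"
    and prec_add: "\<And>\<delta> \<delta>' \<epsilon>. prec \<delta>' \<delta> \<Longrightarrow> prec (\<delta>' + \<epsilon>) (\<delta> + \<epsilon>)"
    and marked: "marked_set J F"
begin

text \<open>
  The bound \<open>D\<close> on the heads makes the induction on heads possible; \<open>D = UNIV\<close> gives the
  space \<open>W\<close> of the introduction.
\<close>

definition cone_span :: "'n expo set \<Rightarrow> ('n, 'a) mpoly set" where
  "cone_span D = poly_space.span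
    {Poly_Mapping.single \<eta> 1 * F \<alpha> | \<alpha> \<eta>. \<alpha> \<in> heads J \<and> \<eta> \<in> mult J \<alpha> \<and> \<alpha> + \<eta> \<in> D}"

lemma subspace_cone_span: "poly_space.subspace (cone_span D)"
  unfolding cone_span_def by (rule poly_space.subspace_span)

lemma cone_multiple_in_cone_span:
  assumes "\<alpha> \<in> heads J" and "\<eta> \<in> mult J \<alpha>" and "\<alpha> + \<eta> \<in> D"
  shows "Poly_Mapping.single \<eta> 1 * F \<alpha> \<in> cone_span D"
  unfolding cone_span_def using assms by (blast intro: poly_space.span_base)

lemma cone_span_minimal:
  assumes "poly_space.subspace V"
    and "\<And>\<alpha> \<eta>. \<alpha> \<in> heads J \<Longrightarrow> \<eta> \<in> mult J \<alpha> \<Longrightarrow> \<alpha> + \<eta> \<in> D \<Longrightarrow>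
      Poly_Mapping.single \<eta> 1 * F \<alpha> \<in> V"
  shows "cone_span D \<subseteq> V"
  unfolding cone_span_def using assms by (intro poly_space.span_minimal) auto

lemma cone_span_subset_ideal: "cone_span D \<subseteq> poly_ideal.span (F ` heads J)"
proof (rule cone_span_minimal)
  show "poly_space.subspace (poly_ideal.span (F ` heads J))"
    unfolding poly_space.subspace_def scale_poly_def
    by (auto intro: poly_ideal.span_zero poly_ideal.span_add poly_ideal.span_scale)
qed (auto intro: poly_ideal.span_scale poly_ideal.span_base)

lemma residual_not_head: "\<alpha> \<in> heads J \<Longrightarrow> \<alpha> + \<eta> \<notin> residual J"
  using heads_subset_head_ideal head_ideal_upward unfolding residual_def by blast

lemma wfp_prec: "wfp prec" and transp_prec: "transp prec" and irreflp_prec: "irreflp prec"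
  using ordered unfolding ordered_by_def well_founded_order_def by auto

lemma lookup_head: "\<alpha> \<in> heads J \<Longrightarrow> Poly_Mapping.lookup (F \<alpha>) \<alpha> = 1"
  using marked unfolding marked_set_def by blast

lemma lookup_head_multiple:
  "\<alpha> \<in> heads J \<Longrightarrow>
    Poly_Mapping.lookup (Poly_Mapping.single \<eta> c * F \<alpha>) (\<alpha> + \<eta>) = c"
  by (simp add: lookup_monomial_mult lookup_head)

lemma keys_marked_cases:
  assumes "\<alpha> \<in> heads J" and "\<kappa> \<in> Poly_Mapping.keys (F \<alpha>)" and "\<kappa> \<noteq> \<alpha>"
  shows "\<kappa> \<in> tail J \<alpha>"
proof -
  have "\<kappa> \<in> Poly_Mapping.keys (F \<alpha> - Poly_Mapping.single \<alpha> 1)"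
    using assms by (simp add: in_keys_iff lookup_minus lookup_single)
  then show ?thesis
    using marked assms(1) unfolding marked_set_def by blast
qed

lemma keys_cone_multiple:
  assumes "\<alpha> \<in> heads J" and "\<eta> \<in> mult J \<alpha>"
    and "\<kappa> \<in> Poly_Mapping.keys (Poly_Mapping.single \<eta> c * F \<alpha>)" and "\<kappa> \<noteq> \<alpha> + \<eta>"
  shows "prec \<kappa> (\<alpha> + \<eta>)"
proof -
  obtain \<kappa>' where "\<kappa>' \<in> Poly_Mapping.keys (F \<alpha>)" and "\<kappa> = \<kappa>' + \<eta>"
    using assms(3) keys_monomial_mult by blast
  then show ?thesis
    using keys_marked_cases[OF assms(1)] assms ordered unfolding ordered_by_def by auto
qed

text \<open>
  Here \<open>\<eta>\<close> may be outside \<open>mult J \<alpha>\<close>: a nonempty order ideal contains \<open>0\<close>, so the tail of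
  \<open>f\<^sub>\<alpha>\<close> is below its head, and the order is compatible with multiplication by \<open>x\<^sup>\<eta>\<close>.
\<close>

lemma keys_multiple:
  assumes "\<alpha> \<in> heads J" and "mult J \<alpha> \<noteq> {}"
    and "\<kappa> \<in> Poly_Mapping.keys (Poly_Mapping.single \<eta> c * F \<alpha>)" and "\<kappa> \<noteq> \<alpha> + \<eta>"
  shows "prec \<kappa> (\<alpha> + \<eta>)"
proof -
  obtain \<kappa>' where \<kappa>': "\<kappa>' \<in> Poly_Mapping.keys (F \<alpha>)" and "\<kappa> = \<kappa>' + \<eta>"
    using assms(3) keys_monomial_mult by blast
  have "order_ideal (mult J \<alpha>)"
    using rs assms(1) unfolding reduction_structure_def by blast
  then have "0 \<in> mult J \<alpha>"
    using assms(2) order_ideal_downward[of _ 0] by auto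
  then have "prec \<kappa>' \<alpha>"
    using keys_cone_multiple[of \<alpha> 0 \<kappa>' 1] \<kappa>' assms \<open>\<kappa> = \<kappa>' + \<eta>\<close> by auto
  then show ?thesis
    using prec_add \<open>\<kappa> = \<kappa>' + \<eta>\<close> by blast
qed

lemma red_step_cone_span:
  assumes "red_step J F g h" and "Poly_Mapping.keys g \<subseteq> D"
    and down: "\<And>\<delta> \<delta>'. \<delta> \<in> D \<Longrightarrow> prec \<delta>' \<delta> \<Longrightarrow> \<delta>' \<in> D"
  shows "g - h \<in> cone_span D" and "Poly_Mapping.keys h \<subseteq> D"
proof -
  from assms(1) obtain \<alpha> \<eta> where \<alpha>: "\<alpha> \<in> heads J" "\<eta> \<in> mult J \<alpha>"
    and g: "\<alpha> + \<eta> \<in> Poly_Mapping.keys g"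
    and h: "h = g - Poly_Mapping.single \<eta> (Poly_Mapping.lookup g (\<alpha> + \<eta>)) * F \<alpha>"
      (is "h = g - ?m")
    unfolding red_step_def by blast
  have D: "\<alpha> + \<eta> \<in> D"
    using g assms(2) by blast
  have "scale_poly (Poly_Mapping.lookup g (\<alpha> + \<eta>)) (Poly_Mapping.single \<eta> 1 * F \<alpha>) \<in> cone_span D"
    by (intro poly_space.subspace_scale subspace_cone_span cone_multiple_in_cone_span \<alpha> D)
  then show "g - h \<in> cone_span D"
    by (simp add: h scale_poly_monomial_mult)
  have "Poly_Mapping.keys ?m \<subseteq> D"
    using keys_cone_multiple[OF \<alpha>] down D by blast
  then show "Poly_Mapping.keys h \<subseteq> D"
    using assms(2) keys_diff[of g ?m] unfolding h by blast
qed

text \<open>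
  All terms that occur during a reduction lie in every order-theoretic down-set containing the
  support of its starting point.
\<close>

lemma reduction_cone_span:
  assumes "(red_step J F)\<^sup>*\<^sup>* g l" and "Poly_Mapping.keys g \<subseteq> D"
    and "\<And>\<delta> \<delta>'. \<delta> \<in> D \<Longrightarrow> prec \<delta>' \<delta> \<Longrightarrow> \<delta>' \<in> D"
  shows "g - l \<in> cone_span D"
  using assms(1,2)
proof (induction rule: converse_rtranclp_induct)
  case base
  show ?case
    using poly_space.subspace_0[OF subspace_cone_span] by simp
next
  case (step g h)
  then have "(g - h) + (h - l) \<in> cone_span D"
    using red_step_cone_span[OF _ _ assms(3)]
    by (intro poly_space.subspace_add subspace_cone_span) auto
  then show ?case
    by simp
qed

lemma reduction_cone_span_UNIV: "(red_step J F)\<^sup>*\<^sup>* g l \<Longrightarrow> g - l \<in> cone_span UNIV"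
  by (rule reduction_cone_span) auto

lemma reduces_fully_exists: "\<exists>l. reduces_fully J F g l"
proof -
  have "wfp (red_step J F)\<inverse>\<inverse>"
    using noetherian marked
    unfolding noetherian_rs_def wfp_def wf_iff_no_infinite_down_chain by auto
  then show ?thesis
  proof (induction g rule: wfp_induct_rule)
    case (less g)
    show ?case
    proof (cases "Poly_Mapping.keys g \<subseteq> residual J")
      case True
      then show ?thesis
        unfolding reduces_fully_def by blast
    next
      case False
      then obtain \<kappa> where "\<kappa> \<in> Poly_Mapping.keys g" and "\<kappa> \<in> (\<Union>\<alpha>\<in>heads J. cone J \<alpha>)"
        using rs unfolding residual_def reduction_structure_def by blast
      then obtain \<alpha> \<eta> where "\<alpha> \<in> heads J" and "\<eta> \<in> mult J \<alpha>"
        and "\<alpha> + \<eta> \<in> Poly_Mapping.keys g"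
        unfolding cone_def by blast
      then obtain h where h: "red_step J F g h"
        unfolding red_step_def by blast
      then obtain l where "reduces_fully J F h l"
        using less by auto
      then show ?thesis
        using h unfolding reduces_fully_def by (meson converse_rtranclp_into_rtranclp)
    qed
  qed
qed

lemma cone_representation_unique:
  assumes "\<alpha> \<in> heads J" "\<eta> \<in> mult J \<alpha>" "\<beta> \<in> heads J" "\<theta> \<in> mult J \<beta>"
    and "\<alpha> + \<eta> = \<beta> + \<theta>"
  shows "\<alpha> = \<beta> \<and> \<eta> = \<theta>"
proof -
  have "\<alpha> + \<eta> \<in> cone J \<alpha> \<inter> cone J \<beta>"
    using assms(2,4) unfolding cone_def by (auto simp: assms(5)) (metis assms(5))
  then have "\<alpha> = \<beta>"
    using disjoint assms unfolding disjoint_cones_def by blast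
  then show ?thesis
    using assms(5) by simp
qed

lemma cone_span_residual:
  assumes g: "g \<in> cone_span D" and res: "Poly_Mapping.keys g \<subseteq> residual J"
  shows "g = 0"
proof (rule ccontr)
  assume "g \<noteq> 0"
  let ?P = "\<lambda>a p. fst p \<in> heads J \<and> snd p \<in> mult J (fst p) \<and>
    a = Poly_Mapping.single (snd p) 1 * F (fst p)"
  obtain T r where T: "finite T" "\<And>a. a \<in> T \<Longrightarrow> \<exists>p. ?P a p"
    and g_eq: "g = (\<Sum>a\<in>T. scale_poly (r a) a)"
    using g unfolding cone_span_def poly_space.span_explicit by fastforce
  obtain w where w: "\<And>a. a \<in> T \<Longrightarrow> ?P a (w a)"
    using T(2) by metis
  let ?h = "\<lambda>a. fst (w a) + snd (w a)"
  have "\<exists>a\<in>T. ?h a \<in> Poly_Mapping.keys (\<Sum>a\<in>T. scale_poly (r a) a)"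
  proof (rule head_in_keys_combination[OF transp_prec irreflp_prec T(1)])
    show "Poly_Mapping.lookup a (?h a) = 1" if "a \<in> T" for a
      using w[OF that] lookup_head_multiple by metis
    show "prec \<kappa> (?h a)" if "a \<in> T" "\<kappa> \<in> Poly_Mapping.keys a" "\<kappa> \<noteq> ?h a" for a \<kappa>
      using w[OF that(1)] that keys_cone_multiple by metis
    show "inj_on ?h T"
      using w cone_representation_unique by (intro inj_onI) metis
    show "(\<Sum>a\<in>T. scale_poly (r a) a) \<noteq> 0"
      using \<open>g \<noteq> 0\<close> g_eq by simp
  qed
  then show False
    using res w residual_not_head unfolding g_eq by blast
qed

lemma reduces_to_zero_iff: "reduces_fully J F g 0 \<longleftrightarrow> g \<in> cone_span UNIV"
proof
  show "reduces_fully J F g 0 \<Longrightarrow> g \<in> cone_span UNIV"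
    using reduction_cone_span_UNIV[of g 0] unfolding reduces_fully_def by simp
next
  assume g: "g \<in> cone_span UNIV"
  obtain l where l: "reduces_fully J F g l"
    using reduces_fully_exists by blast
  then have "g - l \<in> cone_span UNIV"
    unfolding reduces_fully_def by (blast intro: reduction_cone_span_UNIV)
  then have "g - (g - l) \<in> cone_span UNIV"
    by (rule poly_space.subspace_diff[OF subspace_cone_span g])
  then have "l = 0"
    using l cone_span_residual unfolding reduces_fully_def by simp
  then show "reduces_fully J F g 0"
    using l by simp
qed

text \<open>
  The cone span is a subspace of the ideal and has the polynomials supported in \<open>residual J\<close> as a
  complement. The ideal has the same complement exactly if it is no larger.
\<close>

lemma marked_basis_iff_cone_span:
  "marked_basis J F \<longleftrightarrow> poly_ideal.span (F ` heads J) = cone_span UNIV"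
  (is "_ \<longleftrightarrow> ?I = ?W")
proof -
  have N: "poly_space.span ((\<lambda>\<beta>. Poly_Mapping.single \<beta> 1) ` residual J) =
      {p :: ('n, 'a) mpoly. Poly_Mapping.keys p \<subseteq> residual J}"
    by (auto simp: in_span_terms_iff)
  have basis: "marked_basis J F \<longleftrightarrow>
      is_direct_sum ?I {p. Poly_Mapping.keys p \<subseteq> residual J}"
    unfolding marked_basis_def N using marked by blast
  show ?thesis
  proof
    assume "marked_basis J F"
    then have zero: "?I \<inter> {p. Poly_Mapping.keys p \<subseteq> residual J} = {0}"
      unfolding basis is_direct_sum_def by blast
    have "p \<in> ?W" if p: "p \<in> ?I" for p
    proof -
      obtain l where l: "reduces_fully J F p l"
        using reduces_fully_exists by blast
      then have "p - l \<in> ?I"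
        using reduction_cone_span_UNIV cone_span_subset_ideal
        unfolding reduces_fully_def by blast
      then have "p - (p - l) \<in> ?I"
        by (rule poly_ideal.span_diff[OF p])
      then have "l = 0"
        using zero l unfolding reduces_fully_def by auto
      then show ?thesis
        using l reduces_to_zero_iff by simp
    qed
    then show "?I = ?W"
      using cone_span_subset_ideal by blast
  next
    assume eq: "?I = ?W"
    have "\<exists>u v. g = u + v \<and> u \<in> ?W \<and> Poly_Mapping.keys v \<subseteq> residual J" for g
    proof -
      obtain l where "reduces_fully J F g l"
        using reduces_fully_exists by blast
      then have "g = (g - l) + l \<and> g - l \<in> ?W \<and> Poly_Mapping.keys l \<subseteq> residual J"
        using reduction_cone_span_UNIV unfolding reduces_fully_def by simp
      then show ?thesis
        by blast
    qed
    moreover have "0 \<in> ?W"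
      by (rule poly_space.subspace_0[OF subspace_cone_span])
    ultimately show "marked_basis J F"
      unfolding basis eq is_direct_sum_def using cone_span_residual by auto
  qed
qed

section \<open>The S-polynomial criterion\<close>

text \<open>The leading terms of the two parts of an S-polynomial cancel.\<close>

lemma keys_spoly:
  assumes "\<alpha> \<in> heads J" "mult J \<alpha> \<noteq> {}" "\<alpha>' \<in> heads J" "mult J \<alpha>' \<noteq> {}"
    and "\<kappa> \<in> Poly_Mapping.keys (spoly F \<alpha>' \<alpha>)"
  shows "prec \<kappa> (lcm_expo \<alpha> \<alpha>')"
proof -
  let ?m = "lcm_expo \<alpha> \<alpha>'"
  have m: "\<alpha> + (?m - \<alpha>) = ?m" "\<alpha>' + (?m - \<alpha>') = ?m"
    by (metis add.commute lcm_expo_minus_add(1)) (metis add.commute lcm_expo_minus_add(2))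
  have "Poly_Mapping.lookup (spoly F \<alpha>' \<alpha>) ?m = 0"
    using lookup_head_multiple[OF assms(1), of "?m - \<alpha>" 1]
      lookup_head_multiple[OF assms(3), of "?m - \<alpha>'" 1]
    by (simp add: spoly_def lookup_minus m)
  then have "\<kappa> \<noteq> ?m"
    using assms(5) by (auto simp: in_keys_iff)
  moreover have "\<kappa> \<in> Poly_Mapping.keys (Poly_Mapping.single (?m - \<alpha>) 1 * F \<alpha>) \<or>
      \<kappa> \<in> Poly_Mapping.keys (Poly_Mapping.single (?m - \<alpha>') 1 * F \<alpha>')"
    using assms(5) subsetD[OF keys_diff] unfolding spoly_def by (metis Un_iff)
  ultimately show ?thesis
    using keys_multiple[OF assms(1,2), of \<kappa> "?m - \<alpha>" 1]
      keys_multiple[OF assms(3,4), of \<kappa> "?m - \<alpha>'" 1] by (auto simp: m)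
qed

lemma in_cone_iff: "\<gamma> + \<alpha> \<in> cone J \<alpha> \<longleftrightarrow> \<gamma> \<in> mult J \<alpha>"
  unfolding cone_def by (auto simp: add.commute[of \<gamma>])

text \<open>
  As the least common multiple is in the cone of \<open>\<alpha>'\<close>, the second part of the S-polynomial is
  one of the spanning multiples. With \<open>reduces_to_zero_iff\<close> this makes the conditions on
  S-polynomials and on multiples of the \<open>f\<^sub>\<alpha>\<close> equivalent.
\<close>

lemma spoly_in_cone_span_iff:
  assumes "\<alpha>' \<in> heads J" and "lcm_expo \<alpha> \<alpha>' \<in> cone J \<alpha>'"
  shows "spoly F \<alpha>' \<alpha> \<in> cone_span UNIV \<longleftrightarrow>
    Poly_Mapping.single (lcm_expo \<alpha> \<alpha>' - \<alpha>) 1 * F \<alpha> \<in> cone_span UNIV"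
proof -
  have m: "Poly_Mapping.single (lcm_expo \<alpha> \<alpha>' - \<alpha>') 1 * F \<alpha>' \<in> cone_span UNIV"
    using assms in_cone_iff[of "lcm_expo \<alpha> \<alpha>' - \<alpha>'" \<alpha>']
    by (intro cone_multiple_in_cone_span) auto
  show ?thesis
    unfolding spoly_def
    using poly_space.subspace_add[OF subspace_cone_span _ m]
      poly_space.subspace_diff[OF subspace_cone_span _ m]
    by (metis diff_add_cancel)
qed

text \<open>
  A term of the cone of \<open>\<alpha>'\<close> that is a multiple of \<open>x\<^sup>\<alpha>\<close> is a multiple of
  \<open>lcm_expo \<alpha> \<alpha>'\<close>, which lies in that cone because \<open>mult J \<alpha>'\<close> is an order ideal.
\<close>

lemma multiple_head_cases:
  assumes "\<alpha> \<in> heads J"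
  obtains \<alpha>' \<delta> where "\<alpha>' \<in> heads J" and "lcm_expo \<alpha> \<alpha>' \<in> cone J \<alpha>'"
    and "\<gamma> + \<alpha> = lcm_expo \<alpha> \<alpha>' + \<delta>"
    and "\<gamma> + \<alpha> \<in> cone J \<alpha>'"
proof -
  have "\<gamma> + \<alpha> \<in> head_ideal J"
    using heads_subset_head_ideal head_ideal_upward assms by (metis add.commute subsetD)
  then obtain \<alpha>' where \<alpha>': "\<alpha>' \<in> heads J" and cone: "\<gamma> + \<alpha> \<in> cone J \<alpha>'"
    using rs unfolding reduction_structure_def by blast
  then obtain \<eta> where \<eta>: "\<gamma> + \<alpha> = \<eta> + \<alpha>'" "\<eta> \<in> mult J \<alpha>'"
    unfolding cone_def by (auto simp: add.commute)
  obtain \<delta> where \<delta>: "\<gamma> + \<alpha> = lcm_expo \<alpha> \<alpha>' + \<delta>"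
    using lcm_expo_dvd[OF \<eta>(1)] .
  have "\<eta> + \<alpha>' = ((lcm_expo \<alpha> \<alpha>' - \<alpha>') + \<delta>) + \<alpha>'"
    using \<eta>(1) \<delta> by (metis add.assoc add.commute lcm_expo_minus_add(2))
  then have "\<eta> = (lcm_expo \<alpha> \<alpha>' - \<alpha>') + \<delta>"
    by (rule add_right_imp_eq)
  moreover have "order_ideal (mult J \<alpha>')"
    using rs \<alpha>' unfolding reduction_structure_def by blast
  ultimately have "lcm_expo \<alpha> \<alpha>' - \<alpha>' \<in> mult J \<alpha>'"
    using \<eta>(2) order_ideal_downward by blast
  then have "lcm_expo \<alpha> \<alpha>' \<in> cone J \<alpha>'"
    using in_cone_iff[of "lcm_expo \<alpha> \<alpha>' - \<alpha>'" \<alpha>'] by simp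
  then show thesis
    using that \<alpha>' \<delta> cone by blast
qed

lemma spoly_multiple:
  assumes "\<gamma> + \<alpha> = lcm_expo \<alpha> \<alpha>' + \<delta>"
  obtains \<eta> where "\<gamma> + \<alpha> = \<eta> + \<alpha>'"
    and "Poly_Mapping.single \<gamma> 1 * F \<alpha> =
      Poly_Mapping.single \<delta> 1 * spoly F \<alpha>' \<alpha> + Poly_Mapping.single \<eta> 1 * F \<alpha>'"
proof
  let ?m = "lcm_expo \<alpha> \<alpha>'"
  have "\<gamma> + \<alpha> = (\<delta> + (?m - \<alpha>)) + \<alpha>"
    using assms by (metis add.assoc add.commute lcm_expo_minus_add(1))
  then have \<gamma>: "\<gamma> = \<delta> + (?m - \<alpha>)"
    by (rule add_right_imp_eq)
  show "\<gamma> + \<alpha> = (\<delta> + (?m - \<alpha>')) + \<alpha>'"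
    using assms by (metis add.assoc add.commute lcm_expo_minus_add(2))
  show "Poly_Mapping.single \<gamma> 1 * F \<alpha> =
      Poly_Mapping.single \<delta> 1 * spoly F \<alpha>' \<alpha> +
      Poly_Mapping.single (\<delta> + (?m - \<alpha>')) 1 * F \<alpha>'"
    by (simp add: \<gamma> spoly_def right_diff_distrib mult_single flip: mult.assoc)
qed

lemma multiple_in_cone_span:
  assumes crit: "\<And>\<alpha> \<alpha>'. \<alpha> \<in> heads J \<Longrightarrow> \<alpha>' \<in> heads J \<Longrightarrow> lcm_expo \<alpha> \<alpha>' \<in> cone J \<alpha>' \<Longrightarrow>
      reduces_fully J F (spoly F \<alpha>' \<alpha>) 0"
    and "\<alpha> \<in> heads J" and "mult J \<alpha> \<noteq> {}"
  shows "Poly_Mapping.single \<gamma> 1 * F \<alpha> \<in> cone_span UNIV"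
  using wfp_prec assms(2,3)
proof (induction "\<gamma> + \<alpha>" arbitrary: \<gamma> \<alpha> rule: wfp_induct_rule)
  case less
  obtain \<alpha>' \<delta> where \<alpha>': "\<alpha>' \<in> heads J" and lcm: "lcm_expo \<alpha> \<alpha>' \<in> cone J \<alpha>'"
    and \<delta>: "\<gamma> + \<alpha> = lcm_expo \<alpha> \<alpha>' + \<delta>" and cone: "\<gamma> + \<alpha> \<in> cone J \<alpha>'"
    using multiple_head_cases[OF less.prems(1)] .
  obtain \<eta> where \<eta>: "\<gamma> + \<alpha> = \<eta> + \<alpha>'"
    and eq: "Poly_Mapping.single \<gamma> 1 * F \<alpha> =
      Poly_Mapping.single \<delta> 1 * spoly F \<alpha>' \<alpha> + Poly_Mapping.single \<eta> 1 * F \<alpha>'"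
    using spoly_multiple[OF \<delta>] .
  have "\<eta> \<in> mult J \<alpha>'"
    using cone by (simp add: \<eta> in_cone_iff)
  let ?D = "{\<kappa>. prec \<kappa> (lcm_expo \<alpha> \<alpha>')}"
  have "spoly F \<alpha>' \<alpha> - 0 \<in> cone_span ?D"
  proof (rule reduction_cone_span)
    show "(red_step J F)\<^sup>*\<^sup>* (spoly F \<alpha>' \<alpha>) 0"
      using crit[OF less.prems(1) \<alpha>' lcm] unfolding reduces_fully_def by blast
    show "Poly_Mapping.keys (spoly F \<alpha>' \<alpha>) \<subseteq> ?D"
      using keys_spoly less.prems \<alpha>' \<open>\<eta> \<in> mult J \<alpha>'\<close> by blast
    show "\<delta>' \<in> ?D" if "\<delta> \<in> ?D" "prec \<delta>' \<delta>" for \<delta> \<delta>'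
      using that transp_prec by (auto dest: transpD)
  qed
  moreover have "cone_span ?D \<subseteq> {p. Poly_Mapping.single \<delta> 1 * p \<in> cone_span UNIV}"
  proof (rule cone_span_minimal)
    show "poly_space.subspace {p. Poly_Mapping.single \<delta> 1 * p \<in> cone_span UNIV}"
      by (rule subspace_mult_preimage[OF subspace_cone_span])
    show "Poly_Mapping.single \<theta> 1 * F \<beta> \<in> {p. Poly_Mapping.single \<delta> 1 * p \<in> cone_span UNIV}"
      if "\<beta> \<in> heads J" "\<theta> \<in> mult J \<beta>" "\<beta> + \<theta> \<in> ?D" for \<beta> \<theta>
    proof -
      have "prec (\<beta> + \<theta>) (lcm_expo \<alpha> \<alpha>')"
        using that(3) by simp
      then have "prec ((\<delta> + \<theta>) + \<beta>) (\<gamma> + \<alpha>)"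
        using prec_add[of _ _ \<delta>] \<delta> by (fastforce simp: ac_simps)
      then have "Poly_Mapping.single (\<delta> + \<theta>) 1 * F \<beta> \<in> cone_span UNIV"
        using less.hyps that by blast
      then show ?thesis
        by (simp add: mult_single flip: mult.assoc)
    qed
  qed
  ultimately have "Poly_Mapping.single \<delta> 1 * spoly F \<alpha>' \<alpha> \<in> cone_span UNIV"
    by auto
  then show ?case
    unfolding eq using \<alpha>' \<open>\<eta> \<in> mult J \<alpha>'\<close>
    by (intro poly_space.subspace_add subspace_cone_span cone_multiple_in_cone_span) auto
qed

text \<open>
  If \<open>mult J \<alpha>\<close> is empty, the order says nothing about \<open>f\<^sub>\<alpha>\<close>. But then \<open>x\<^sup>\<alpha>\<close> itself lies
  in the cone of some \<open>\<alpha>'\<close>, so the criterion reduces \<open>f\<^sub>\<alpha>\<close> modulo a multiple of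
  \<open>f\<^sub>\<alpha>\<^sub>'\<close> to zero. This writes \<open>f\<^sub>\<alpha>\<close> as a combination of multiples of the \<open>f\<^sub>\<beta>\<close>
  with \<open>mult J \<beta>\<close> not empty, and their further multiples are known to lie in the cone span.
\<close>

lemma ideal_subset_cone_span:
  assumes crit: "\<And>\<alpha> \<alpha>'. \<alpha> \<in> heads J \<Longrightarrow> \<alpha>' \<in> heads J \<Longrightarrow> lcm_expo \<alpha> \<alpha>' \<in> cone J \<alpha>' \<Longrightarrow>
      reduces_fully J F (spoly F \<alpha>' \<alpha>) 0"
  shows "poly_ideal.span (F ` heads J) \<subseteq> cone_span UNIV"
proof (rule ideal_span_subset_subspace[OF subspace_cone_span])
  fix f \<gamma>
  assume "f \<in> F ` heads J"
  then obtain \<alpha> where \<alpha>: "\<alpha> \<in> heads J" and f: "f = F \<alpha>"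
    by blast
  obtain \<alpha>' \<delta> where \<alpha>': "\<alpha>' \<in> heads J" and lcm: "lcm_expo \<alpha> \<alpha>' \<in> cone J \<alpha>'"
    and "0 + \<alpha> = lcm_expo \<alpha> \<alpha>' + \<delta>"
    using multiple_head_cases[OF \<alpha>, of 0] .
  then have "Poly_Mapping.lookup \<alpha> i =
      max (Poly_Mapping.lookup \<alpha> i) (Poly_Mapping.lookup \<alpha>' i) + Poly_Mapping.lookup \<delta> i" for i
    by (metis add_0 lookup_add lookup_lcm_expo)
  then have "lcm_expo \<alpha> \<alpha>' = \<alpha>"
    by (intro poly_mapping_eqI) (metis lookup_lcm_expo max.cobounded1 le_add1 le_antisym)
  then have "F \<alpha> \<in> cone_span UNIV"
    using crit[OF \<alpha> \<alpha>' lcm] spoly_in_cone_span_iff[OF \<alpha>' lcm] by (simp add: reduces_to_zero_iff)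
  moreover have "cone_span UNIV \<subseteq> {p. Poly_Mapping.single \<gamma> 1 * p \<in> cone_span UNIV}"
  proof (rule cone_span_minimal)
    show "poly_space.subspace {p. Poly_Mapping.single \<gamma> 1 * p \<in> cone_span UNIV}"
      by (rule subspace_mult_preimage[OF subspace_cone_span])
    show "Poly_Mapping.single \<theta> 1 * F \<beta> \<in> {p. Poly_Mapping.single \<gamma> 1 * p \<in> cone_span UNIV}"
      if "\<beta> \<in> heads J" "\<theta> \<in> mult J \<beta>" for \<beta> \<theta>
    proof -
      have "Poly_Mapping.single (\<gamma> + \<theta>) 1 * F \<beta> \<in> cone_span UNIV"
        using crit that by (intro multiple_in_cone_span) auto
      then show ?thesis
        by (simp add: mult_single flip: mult.assoc)
    qed
  qed
  ultimately show "Poly_Mapping.single \<gamma> 1 * f \<in> cone_span UNIV"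
    unfolding f by blast
qed

end

theorem corollary8p3:
  fixes J :: "'n::finite red_triple"
    and prec :: "'n expo \<Rightarrow> 'n expo \<Rightarrow> bool"
    and F :: "'n expo \<Rightarrow> ('n, 'a::field) mpoly"
  assumes "reduction_structure J"
    and "noetherian_rs TYPE('a) J"
    and "disjoint_cones J"
    and "ordered_by J prec"
    and "\<And>\<delta> \<delta>' \<epsilon>. prec \<delta>' \<delta> \<Longrightarrow>
           prec (\<delta>' + \<epsilon>) (\<delta> + \<epsilon>) \<and> (prec \<epsilon> (\<delta>' + \<epsilon>) \<or> \<epsilon> = \<delta>' + \<epsilon>)"
    and "marked_set J F"
  shows "(marked_basis J F \<longleftrightarrow>
      (\<forall>\<alpha>\<in>heads J. \<forall>\<alpha>'\<in>heads J. lcm_expo \<alpha> \<alpha>' \<in> cone J \<alpha>' \<longrightarrow>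
         reduces_fully J F (spoly F \<alpha>' \<alpha>) 0)) \<and>
    (marked_basis J F \<longleftrightarrow>
      (\<forall>\<alpha>\<in>heads J. \<forall>\<alpha>'\<in>heads J. \<forall>\<gamma>. \<gamma> + \<alpha> = lcm_expo \<alpha> \<alpha>' \<and> lcm_expo \<alpha> \<alpha>' \<in> cone J \<alpha>' \<longrightarrow>
         reduces_fully J F (Poly_Mapping.single \<gamma> 1 * F \<alpha>) 0))"
    (is "(_ \<longleftrightarrow> ?ii) \<and> (_ \<longleftrightarrow> ?iii)")
proof -
  interpret ordered_marked_set J prec F
  proof
    show "prec (\<delta>' + \<epsilon>) (\<delta> + \<epsilon>)" if "prec \<delta>' \<delta>" for \<delta> \<delta>' \<epsilon>
      using assms(5)[OF that] by (rule conjunct1)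
  qed (fact assms)+
  have "\<gamma> + \<alpha> = lcm_expo \<alpha> \<alpha>' \<longleftrightarrow> \<gamma> = lcm_expo \<alpha> \<alpha>' - \<alpha>" for \<alpha> \<alpha>' \<gamma> :: "'n expo"
    by (metis add_diff_cancel_right' lcm_expo_minus_add(1))
  then have "?ii \<longleftrightarrow> ?iii"
    using spoly_in_cone_span_iff by (auto simp: reduces_to_zero_iff)
  moreover have "marked_basis J F \<longleftrightarrow> ?iii"
  proof
    assume "marked_basis J F"
    then have "cone_span UNIV = poly_ideal.span (F ` heads J)"
      by (simp add: marked_basis_iff_cone_span)
    then show ?iii
      by (auto simp: reduces_to_zero_iff intro: poly_ideal.span_scale poly_ideal.span_base)
  next
    assume ?iii
    then have ?ii
      using \<open>?ii \<longleftrightarrow> ?iii\<close> by blast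
    then show "marked_basis J F"
      unfolding marked_basis_iff_cone_span
      using ideal_subset_cone_span cone_span_subset_ideal by blast
  qed
  ultimately show ?thesis
    by blast
qed

end
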